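(* Let $X$ be a finite ultrametric space such that the representing tree $T_X$ is strictly binary. Then for every nonempty subspace $Y$ of $X$ the representing tree $T_Y$ is strictly binary.
   Context: Representing tree: let $(X,d)$ be a finite nonempty ultrametric space. If $|X|\geq 2$, the diametrical graph of $X$ is the graph with vertex set $X$ in which $u,v$ are adjacent iff $d(u,v)=\operatorname{diam}X$, where $\operatorname{diam} X=\max\{d(x,y):x,y\in X\}$; it is always complete $k$-partite for some $k\geq 2$, with uniquely determined nonempty parts $X_1,\dots,X_k$. The representing tree $(T_X,l_X)$ is the rooted labeled tree whose nodes are subsets of $X$, defined recursively: if $|X|=1$, $T_X$ consists of the single node $X$ labeled $0$; if $|X|\geq 2$, the root $X$ is labeled $\operatorname{diam}X$, its children are the parts $X_1,\dots,X_k$ of the diametrical graph of $X$, each child $X_i$ is labeled $l_X(X_i)=\operatorname{diam}X_i$, and the construction is repeated for every $X_i$ with $|X_i|\geq2$. The leaves of $T_X$ are exactly the singletons $\{x\}$, $x\in X$; the other nodes are internal. A rooted tree is strictly binary if every internal node has exactly two children (a tree consisting of a single node is strictly binary, vacuously). Subspaces carry the restricted metric. *)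

theory Defs
  imports "HOL-Analysis.Analysis" "HOL-Library.Disjoint_Sets"
begin

(* The locale Metric_space asks that d be nonnegative and symmetric on the whole
   type; every metric on M extends to such a function, and only the
   values of d on M \<times> M are used below. *)
locale ultrametric_space = Metric_space +
  assumes ultra: "\<lbrakk>x \<in> M; y \<in> M; z \<in> M\<rbrakk> \<Longrightarrow> d x z \<le> max (d x y) (d y z)"

lemma ultrametric_space_subset:
  assumes "ultrametric_space M d" "N \<subseteq> M"
  shows "ultrametric_space N d"
proof -
  interpret ultrametric_space M d by fact
  interpret N: Metric_space N d using subspace assms(2) by blast
  show ?thesis
    by unfold_locales (use assms(2) ultra in blast)
qed

definition diam :: "('a \<Rightarrow> 'a \<Rightarrow> real) \<Rightarrow> 'a set \<Rightarrow> real" where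
  "diam d X = Max {d x y |x y. x \<in> X \<and> y \<in> X}"

definition diametrical_graph :: "('a \<Rightarrow> 'a \<Rightarrow> real) \<Rightarrow> 'a set \<Rightarrow> 'a rel" where
  "diametrical_graph d X = {(u, v). u \<in> X \<and> v \<in> X \<and> d u v = diam d X}"

(* The graph with vertex set V and adjacency relation E is complete k-partite for
   k = card P \<ge> 2, with P the set of its (nonempty) parts. *)
definition complete_multipartite :: "'a set \<Rightarrow> 'a rel \<Rightarrow> 'a set set \<Rightarrow> bool" where
  "complete_multipartite V E P \<longleftrightarrow>
     partition_on V P \<and> 2 \<le> card P \<and>
     E = {(u, v). \<exists>A\<in>P. \<exists>B\<in>P. A \<noteq> B \<and> u \<in> A \<and> v \<in> B}"

(* Meaningful for 2 \<le> card X, see diametrical_parts below. *)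
definition diametrical_parts :: "('a \<Rightarrow> 'a \<Rightarrow> real) \<Rightarrow> 'a set \<Rightarrow> 'a set set" where
  "diametrical_parts d X = (THE P. complete_multipartite X (diametrical_graph d X) P)"

record ('v, 'l) labeled_tree =
  root_node :: 'v
  nodes :: "'v set"
  children :: "'v \<Rightarrow> 'v set"
  label :: "'v \<Rightarrow> 'l"

definition internal :: "('v, 'l) labeled_tree \<Rightarrow> 'v \<Rightarrow> bool" where
  "internal T v \<longleftrightarrow> v \<in> nodes T \<and> children T v \<noteq> {}"

definition strictly_binary :: "('v, 'l) labeled_tree \<Rightarrow> bool" where
  "strictly_binary T \<longleftrightarrow> (\<forall>v. internal T v \<longrightarrow> card (children T v) = 2)"

definition rep_children :: "('a \<Rightarrow> 'a \<Rightarrow> real) \<Rightarrow> 'a set \<Rightarrow> 'a set set" where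
  "rep_children d A = (if 2 \<le> card A then diametrical_parts d A else {})"

inductive_set rep_nodes :: "('a \<Rightarrow> 'a \<Rightarrow> real) \<Rightarrow> 'a set \<Rightarrow> 'a set set"
  for d :: "'a \<Rightarrow> 'a \<Rightarrow> real" and X :: "'a set" where
  root: "X \<in> rep_nodes d X"
| child: "A \<in> rep_nodes d X \<Longrightarrow> B \<in> rep_children d A \<Longrightarrow> B \<in> rep_nodes d X"

(* Singletons get the label 0, since diam d {x} = d x x = 0. *)
definition rep_tree :: "('a \<Rightarrow> 'a \<Rightarrow> real) \<Rightarrow> 'a set \<Rightarrow> ('a set, real) labeled_tree" where
  "rep_tree d X =
     \<lparr>root_node = X, nodes = rep_nodes d X, children = rep_children d, label = diam d\<rparr>"


lemma complete_multipartite_unique: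
  assumes "complete_multipartite V E P"
  shows "P = (\<lambda>u. {v \<in> V. (u, v) \<notin> E}) ` V"
proof -
  have part: "partition_on V P"
    and E: "E = {(u, v). \<exists>A\<in>P. \<exists>B\<in>P. A \<noteq> B \<and> u \<in> A \<and> v \<in> B}"
    using assms by (auto simp: complete_multipartite_def)
  have V: "V = \<Union>P" and ne: "{} \<notin> P"
    using part by (auto simp: partition_on_def)
  have disj: "A = B" if "A \<in> P" "B \<in> P" "x \<in> A" "x \<in> B" for A B x
    using part that by (auto simp: partition_on_def disjoint_def)
  have *: "{v \<in> V. (u, v) \<notin> E} = A" if "A \<in> P" "u \<in> A" for A u
    using that disj unfolding E V by blast
  show ?thesis
  proof (intro equalityI subsetI)
    fix A assume A: "A \<in> P"
    then obtain u where "u \<in> A" using ne by (metis equals0I)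
    then show "A \<in> (\<lambda>u. {v \<in> V. (u, v) \<notin> E}) ` V"
      using A * V by blast
  next
    fix A assume "A \<in> (\<lambda>u. {v \<in> V. (u, v) \<notin> E}) ` V"
    then show "A \<in> P" using * V by auto
  qed
qed

lemma diam_ge:
  assumes "finite X" "x \<in> X" "y \<in> X"
  shows "d x y \<le> diam d X"
proof -
  have "{d x y |x y. x \<in> X \<and> y \<in> X} = case_prod d ` (X \<times> X)" by auto
  with assms show ?thesis unfolding diam_def by (intro Max_ge) auto
qed

lemma diam_attained:
  assumes "finite X" "X \<noteq> {}"
  obtains x y where "x \<in> X" "y \<in> X" "d x y = diam d X"
proof -
  have "{d x y |x y. x \<in> X \<and> y \<in> X} = case_prod d ` (X \<times> X)" by auto
  then have "diam d X \<in> {d x y |x y. x \<in> X \<and> y \<in> X}"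
    unfolding diam_def using assms by (intro Max_in) auto
  then show ?thesis using that by auto
qed

lemma (in ultrametric_space) diametrical_parts:
  assumes "finite M" "2 \<le> card M"
  shows "\<exists>!P. complete_multipartite M (diametrical_graph d M) P"
    and "complete_multipartite M (diametrical_graph d M) (diametrical_parts d M)"
proof -
  define D where "D = diam d M"
  have le: "d x y \<le> D" if "x \<in> M" "y \<in> M" for x y
    using diam_ge assms(1) that unfolding D_def by metis
  obtain p q where pq: "p \<in> M" "q \<in> M" "p \<noteq> q"
    using assms(2) by (auto simp: numeral_2_eq_2 card_le_Suc_iff)
  have "0 < d p q" using pq by simp
  then have D: "0 < D" using le pq by (meson less_le_trans)
  define r where "r = {(x, y). x \<in> M \<and> y \<in> M \<and> d x y < D}"
  have equiv: "equiv M r"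
  proof (rule equivI)
    show "r \<subseteq> M \<times> M" by (auto simp: r_def)
    show "refl_on M r" using D by (auto simp: r_def refl_on_def)
    show "sym r" by (auto simp: r_def sym_def commute)
    show "trans r"
    proof (rule transI)
      fix x y z assume "(x, y) \<in> r" "(y, z) \<in> r"
      then show "(x, z) \<in> r"
        using ultra[of x y z] by (auto simp: r_def)
    qed
  qed
  define P where "P = M // r"
  have part: "partition_on M P" unfolding P_def by (rule partition_on_quotient[OF equiv])
  have G: "diametrical_graph d M = {(u, v). u \<in> M \<and> v \<in> M \<and> (u, v) \<notin> r}"
    using le by (force simp: diametrical_graph_def r_def D_def[symmetric])
  have E: "diametrical_graph d M = {(u, v). \<exists>A\<in>P. \<exists>B\<in>P. A \<noteq> B \<and> u \<in> A \<and> v \<in> B}"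
  proof (intro equalityI subsetI; clarify)
    fix u v assume "(u, v) \<in> diametrical_graph d M"
    then have uv: "u \<in> M" "v \<in> M" "(u, v) \<notin> r" by (auto simp: G)
    then have "r `` {u} \<noteq> r `` {v}" by (metis equiv eq_equiv_class)
    moreover have "u \<in> r `` {u}" "v \<in> r `` {v}"
      using uv D by (auto simp: r_def)
    moreover have "r `` {u} \<in> P" "r `` {v} \<in> P"
      using uv by (auto simp: P_def quotientI)
    ultimately show "\<exists>A\<in>P. \<exists>B\<in>P. A \<noteq> B \<and> u \<in> A \<and> v \<in> B"
      by (intro bexI[of _ "r `` {u}"] bexI[of _ "r `` {v}"] conjI)
  next
    fix u v A B assume AB: "A \<in> P" "B \<in> P" "u \<in> A" "v \<in> B" "A \<noteq> B"
    have "u \<in> M" "v \<in> M"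
      using part AB by (auto simp: partition_on_def)
    moreover have "(u, v) \<notin> r"
      using quotient_eq_iff[OF equiv, of A B u v] AB by (simp add: P_def)
    ultimately show "(u, v) \<in> diametrical_graph d M" by (simp add: G)
  qed
  obtain x y where "x \<in> M" "y \<in> M" "d x y = diam d M"
    using diam_attained[of M d] assms(1) pq by blast
  then have "(x, y) \<in> diametrical_graph d M" by (simp add: diametrical_graph_def)
  then obtain A B where AB: "A \<in> P" "B \<in> P" "A \<noteq> B" by (auto simp: E)
  have "finite P" using part assms(1) by (rule finite_elements[rotated])
  then have "card {A, B} \<le> card P" using AB by (intro card_mono) auto
  then have mp: "complete_multipartite M (diametrical_graph d M) P"
    using part E AB by (simp add: complete_multipartite_def)
  from mp show ex1: "\<exists>!P. complete_multipartite M (diametrical_graph d M) P"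
  proof (rule ex1I)
    fix Q assume "complete_multipartite M (diametrical_graph d M) Q"
    then show "Q = P"
      using complete_multipartite_unique[of M "diametrical_graph d M" Q]
        complete_multipartite_unique[of M "diametrical_graph d M" P] mp by simp
  qed
  show "complete_multipartite M (diametrical_graph d M) (diametrical_parts d M)"
    unfolding diametrical_parts_def using ex1 by (rule theI')
qed

lemma (in ultrametric_space) rep_nodes_subset:
  assumes "finite M" "M \<noteq> {}" "A \<in> rep_nodes d M"
  shows "A \<subseteq> M \<and> A \<noteq> {}"
  using assms(3)
proof induction
  case root
  then show ?case using assms by simp
next
  case (child A B)
  interpret A: ultrametric_space A d
    using child.IH ultrametric_space_subset ultrametric_space_axioms by blast
  have "partition_on A (diametrical_parts d A)" "B \<in> diametrical_parts d A"
    using child A.diametrical_parts(2) assms(1) finite_subset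
    by (auto simp: rep_children_def complete_multipartite_def split: if_splits)
  then show ?case using child.IH by (auto simp: partition_on_def)
qed

lemma (in ultrametric_space) internal_rep_tree_iff:
  assumes "finite M" "M \<noteq> {}"
  shows "internal (rep_tree d M) A \<longleftrightarrow> A \<in> rep_nodes d M \<and> 2 \<le> card A"
proof (cases "A \<in> rep_nodes d M \<and> 2 \<le> card A")
  case True
  then have A: "A \<subseteq> M" using rep_nodes_subset[OF assms] by simp
  then interpret A: ultrametric_space A d
    by (rule ultrametric_space_subset[OF ultrametric_space_axioms])
  have "2 \<le> card (diametrical_parts d A)"
    using A.diametrical_parts(2) True finite_subset[OF A assms(1)]
    by (simp add: complete_multipartite_def)
  then show ?thesis using True by (auto simp: internal_def rep_tree_def rep_children_def)
next
  case False
  then show ?thesis by (auto simp: internal_def rep_tree_def rep_children_def)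
qed

end

(* A strictly binary representing tree means exactly that the space contains no three
   distinct points at equal mutual distances, and this property passes to subspaces.
   Three parts of a node give such points, by picking one in each. Conversely, the smallest
   node containing such points has them in three different parts. *)
theory Submission
  imports Defs
begin

text \<open>Parts are pairwise disjoint, so \<open>A\<close> and \<open>B\<close> are the only parts
  containing \<open>u\<close> and \<open>v\<close>, and an edge between these points can only come
  from this pair.\<close>

lemma complete_multipartite_edge_iff:
  assumes "complete_multipartite V E P" "A \<in> P" "B \<in> P" "u \<in> A" "v \<in> B"
  shows "(u, v) \<in> E \<longleftrightarrow> A \<noteq> B"
proof -
  have "C = D" if "C \<in> P" "D \<in> P" "x \<in> C" "x \<in> D" for C D x
    using assms(1) that by (auto simp: complete_multipartite_def partition_on_def disjoint_def)
  moreover have "E = {(u, v). \<exists>A\<in>P. \<exists>B\<in>P. A \<noteq> B \<and> u \<in> A \<and> v \<in> B}"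
    using assms(1) by (simp add: complete_multipartite_def)
  ultimately show ?thesis
    using assms(2-5) by blast
qed

context ultrametric_space
begin

lemma diametrical_parts_subset:
  assumes "finite M" "A \<subseteq> M" "2 \<le> card A"
  shows "complete_multipartite A (diametrical_graph d A) (diametrical_parts d A)"
proof -
  interpret A: ultrametric_space A d
    using ultrametric_space_axioms assms(2) by (rule ultrametric_space_subset)
  show ?thesis
    using A.diametrical_parts(2) assms finite_subset by blast
qed

lemma strictly_binary_iff:
  assumes "finite M" "M \<noteq> {}"
  shows "strictly_binary (rep_tree d M) \<longleftrightarrow>
    (\<forall>A\<in>rep_nodes d M. 2 \<le> card A \<longrightarrow> card (diametrical_parts d A) = 2)"
  unfolding strictly_binary_def internal_rep_tree_iff[OF assms]
  by (auto simp: rep_tree_def rep_children_def)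

text \<open>This form of the criterion mentions only points and distances, not the recursion that
  builds the tree, so it can be compared between a space and a subspace. Since
  \<open>x \<noteq> y\<close> makes the common distance positive, the three points are pairwise
  distinct.\<close>

lemma strictly_binary_iff_no_equilateral:
  assumes fin: "finite M" and ne: "M \<noteq> {}"
  shows "strictly_binary (rep_tree d M) \<longleftrightarrow>
    (\<nexists>x y z. x \<in> M \<and> y \<in> M \<and> z \<in> M \<and> x \<noteq> y \<and> d x y = d x z \<and> d x y = d y z)"
    (is "_ \<longleftrightarrow> \<not> ?E")
proof -
  have branching: "\<exists>A\<in>rep_nodes d M. 2 \<le> card A \<and> card (diametrical_parts d A) \<noteq> 2" if E: ?E
  proof -
    obtain x y z where xyz: "x \<in> M" "y \<in> M" "z \<in> M" "x \<noteq> y" "d x y = d x z" "d x y = d y z"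
      using E by blast
    define Q where "Q A \<longleftrightarrow> A \<in> rep_nodes d M \<and> {x, y, z} \<subseteq> A" for A
    have "Q M" using rep_nodes.root xyz by (auto simp: Q_def)
    define A where "A = arg_min card Q"
    have "Q A" and min: "\<And>B. Q B \<Longrightarrow> card A \<le> card B"
      using arg_min_natI[of Q M card] arg_min_nat_le[of Q _ card] \<open>Q M\<close> by (simp_all add: A_def)
    then have A: "A \<in> rep_nodes d M" "{x, y, z} \<subseteq> A" by (auto simp: Q_def)
    have AM: "A \<subseteq> M" and finA: "finite A"
      using rep_nodes_subset[OF fin ne A(1)] fin finite_subset by auto
    have "card {x, y} \<le> card A"
      using A(2) finA by (intro card_mono) auto
    then have cA: "2 \<le> card A" using xyz by simp
    define P where "P = diametrical_parts d A"
    have mp: "complete_multipartite A (diametrical_graph d A) P"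
      unfolding P_def using fin AM cA by (rule diametrical_parts_subset)
    then have part: "partition_on A P" and P2: "2 \<le> card P"
      by (auto simp: complete_multipartite_def)
    have finP: "finite P" using finite_elements[OF finA part] .
    obtain B C D where BCD: "B \<in> P" "C \<in> P" "D \<in> P" "x \<in> B" "y \<in> C" "z \<in> D"
      using A(2) by (auto simp: partition_onD1[OF part])
    note edge = complete_multipartite_edge_iff[OF mp BCD(1,2,4,5)]
      complete_multipartite_edge_iff[OF mp BCD(1,3,4,6)]
      complete_multipartite_edge_iff[OF mp BCD(2,3,5,6)]
    \<comment> \<open>The three distances are equal, so either all three pairs are edges of the
      diametrical graph of \<open>A\<close> or none is.\<close>
    have "B \<noteq> C \<and> B \<noteq> D \<and> C \<noteq> D"
    proof (cases "d x y = diam d A")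
      case True
      then have "(x, y) \<in> diametrical_graph d A" "(x, z) \<in> diametrical_graph d A"
        "(y, z) \<in> diametrical_graph d A"
        using A(2) xyz by (auto simp: diametrical_graph_def)
      then show ?thesis using edge by simp
    next
      case False
      then have "(x, y) \<notin> diametrical_graph d A" "(x, z) \<notin> diametrical_graph d A"
        using xyz by (auto simp: diametrical_graph_def)
      \<comment> \<open>Without edges the three parts coincide, so the child \<open>B\<close> of
        \<open>A\<close> competes with \<open>A\<close> for minimality.\<close>
      then have "{x, y, z} \<subseteq> B" using edge BCD(4-6) by simp
      moreover have "B \<in> rep_nodes d M"
        using A(1) BCD(1) cA by (auto simp: P_def rep_children_def intro: rep_nodes.child)
      ultimately have "card A \<le> card B" using min by (auto simp: Q_def)
      moreover have "B \<subseteq> A" using part BCD(1) by (auto simp: partition_on_def)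
      ultimately have "B = A" using card_seteq[OF finA] by blast
      \<comment> \<open>A part equal to all of \<open>A\<close> leaves no point for a second part,
        which contradicts \<open>P2\<close>; this case is therefore impossible.\<close>
      have "C = B" if "C \<in> P" for C
      proof (rule ccontr)
        assume "C \<noteq> B"
        then have "C \<inter> B = {}"
          using disjointD[OF partition_onD2[OF part] that BCD(1)] by simp
        moreover have "C \<subseteq> B" "C \<noteq> {}"
          using part that \<open>B = A\<close> by (auto simp: partition_on_def)
        ultimately show False by blast
      qed
      then have "P \<subseteq> {B}" by blast
      then have "card P \<le> card {B}" by (intro card_mono) auto
      then show ?thesis using P2 by simp
    qed
    then have "card {B, C, D} = 3" by auto
    moreover have "card {B, C, D} \<le> card P" using BCD finP by (intro card_mono) auto
    ultimately have "card P \<noteq> 2" by simp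
    then show ?thesis using A(1) cA unfolding P_def by blast
  qed
  have equilateral: ?E
    if A: "A \<in> rep_nodes d M" "2 \<le> card A" "card (diametrical_parts d A) \<noteq> 2" for A
  proof -
    have AM: "A \<subseteq> M" using rep_nodes_subset[OF fin ne A(1)] by simp
    define P where "P = diametrical_parts d A"
    have mp: "complete_multipartite A (diametrical_graph d A) P"
      unfolding P_def using fin AM A(2) by (rule diametrical_parts_subset)
    \<comment> \<open>A complete multipartite graph has at least two parts here, and exactly two is
      excluded by assumption.\<close>
    then have part: "partition_on A P" and "3 \<le> card P"
      using A(3) by (auto simp: complete_multipartite_def P_def)
    then obtain B C D where BCD: "B \<in> P" "C \<in> P" "D \<in> P" "B \<noteq> C" "B \<noteq> D" "C \<noteq> D"
      by (auto simp: numeral_3_eq_3 card_le_Suc_iff)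
    have "B \<noteq> {}" "C \<noteq> {}" "D \<noteq> {}" using part BCD by (auto simp: partition_on_def)
    then obtain x y z where xyz: "x \<in> B" "y \<in> C" "z \<in> D" by blast
    have "x \<in> M" "y \<in> M" "z \<in> M"
      using part BCD xyz AM by (auto simp: partition_on_def)
    moreover have "x \<noteq> y"
      using part BCD xyz by (auto simp: partition_on_def disjoint_def)
    \<comment> \<open>Points in different parts are adjacent, so all three distances equal
      \<open>diam d A\<close>.\<close>
    moreover have "(x, y) \<in> diametrical_graph d A" "(x, z) \<in> diametrical_graph d A"
        "(y, z) \<in> diametrical_graph d A"
      using BCD xyz by (simp_all add: complete_multipartite_edge_iff[OF mp])
    then have "d x y = d x z" "d x y = d y z" by (auto simp: diametrical_graph_def)
    ultimately show ?E by blast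
  qed
  show ?thesis
    unfolding strictly_binary_iff[OF assms]
  proof
    assume "\<forall>A\<in>rep_nodes d M. 2 \<le> card A \<longrightarrow> card (diametrical_parts d A) = 2"
    then have "\<not> (\<exists>A\<in>rep_nodes d M. 2 \<le> card A \<and> card (diametrical_parts d A) \<noteq> 2)"
      by blast
    then show "\<not> ?E" by (rule contrapos_nn) (rule branching)
  next
    assume "\<not> ?E"
    then show "\<forall>A\<in>rep_nodes d M. 2 \<le> card A \<longrightarrow> card (diametrical_parts d A) = 2"
      by (intro ballI impI) (erule contrapos_np, rule equilateral)
  qed
qed

end

theorem mainTheorem5:
  fixes X Y :: "'a set" and d :: "'a \<Rightarrow> 'a \<Rightarrow> real"
  assumes "ultrametric_space X d" and "finite X" and "X \<noteq> {}"
    and "strictly_binary (rep_tree d X)"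
    and "Y \<subseteq> X" and "Y \<noteq> {}"
  shows "strictly_binary (rep_tree d Y)"
proof -
  interpret X: ultrametric_space X d by fact
  interpret Y: ultrametric_space Y d
    using assms(1,5) by (rule ultrametric_space_subset)
  have "finite Y" using assms(2,5) finite_subset by blast
  then show ?thesis
    \<comment> \<open>Both criteria use the same \<open>d\<close>, so three such points in
      \<open>Y\<close> would also be three such points in \<open>X\<close>.\<close>
    using X.strictly_binary_iff_no_equilateral Y.strictly_binary_iff_no_equilateral assms(2-6)
    by blast
qed

end
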